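(* For any $a>0$, any $\sigma>0$ and any integer $n\ge 1$, there exist a regular sublinear expectation space $(\Omega,\mathcal{H},\hat{\mathbb{E}})$ and random variables $\{X_i\}_{i=1}^n\subset L^2(\Omega;\mathbb{R})$, independent under $\hat{\mathbb{E}}$, with $|X_i|\le M$ for some $M>0$ and $\Theta_i=[-a,a]$ for all $i$, such that for every $t\in\left(0,\ \frac{\sigma}{4\sqrt n}\right]$, \[ \hat V\!\left(\rho_\Theta\!\left(\frac1n\sum_{i=1}^n X_i\right)>t\right)\ge \frac14\exp\!\left(-\frac{2nt^2}{\sigma^2}\right). \]
   Context: A regular sublinear expectation space $(\Omega,\mathcal{H},\hat{\mathbb{E}})$ consists of a complete separable metric space $\Omega$, the space $\mathcal{H}=C_{b.\mathrm{Lip}}(\Omega)$ of bounded Lipschitz real functions on $\Omega$, and a functional $\hat{\mathbb{E}}:\mathcal{H}\to\mathbb{R}$ that is monotone, constant preserving, subadditive and positively homogeneous, and such that $X_k\in\mathcal{H}$, $X_k\downarrow 0$ implies $\hat{\mathbb{E}}[X_k]\downarrow 0$. By a known representation theorem there is a convex, weakly compact set $\mathcal{P}$ of probability measures on $(\Omega,\mathcal{B}(\Omega))$ with $\hat{\mathbb{E}}[X]=\sup_{P\in\mathcal{P}}E_P[X]$ for $X\in\mathcal{H}$. The upper capacity is $\hat V(A)=\sup_{P\in\mathcal{P}}P(A)$. $L^p(\Omega)$ is the completion of $\mathcal{H}$ under $\|X\|_p=(\hat{\mathbb{E}}[|X|^p])^{1/p}$, also written $L^p(\Omega;\mathbb{R})$;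 $\hat{\mathbb{E}}$ and the representation extend to $L^1(\Omega)$. Independence: $\{X_i\}_{i=1}^n\subset L^1(\Omega)$ is independent under $\hat{\mathbb{E}}$ if for each $1\le i\le n-1$ and every bounded Lipschitz $\psi:\mathbb{R}^{i+1}\to\mathbb{R}$, $\hat{\mathbb{E}}[\psi(X_1,\dots,X_i,X_{i+1})]=\hat{\mathbb{E}}\big[\hat{\mathbb{E}}[\psi(x_1,\dots,x_i,X_{i+1})]\big|_{(x_1,\dots,x_i)=(X_1,\dots,X_i)}\big]$. For each $i$, $\Theta_i=\{\theta\in\mathbb{R}:\theta p\le\hat{\mathbb{E}}[pX_i]\ \forall p\in\mathbb{R}\}$, known to equal $\{E_P[X_i]:P\in\mathcal{P}\}$ for independent $X_i$ in $L^2$. Further, $\Theta=\{\frac1n\sum_{i=1}^n\theta_i:\theta_i\in\Theta_i\}$ and $\rho_\Theta(x)=\inf_{\theta\in\Theta}|x-\theta|$. *)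

theory Defs
  imports "HOL-Probability.Probability"
begin

text \<open>
  A metric space with carrier is an element of the library type \<^typ>\<open>'a metric\<close>. Functions on it
  are total functions on \<^typ>\<open>'a\<close> of which only the values on \<^term>\<open>mspace \<Omega>\<close> matter.
\<close>

definition Cb_Lip :: "'a metric \<Rightarrow> ('a \<Rightarrow> real) set" where
  "Cb_Lip \<Omega> = {X. Lipschitz_continuous_map \<Omega> euclidean_metric X \<and> bounded (X ` mspace \<Omega>)}"

definition regular_sublinear_expectation_space ::
    "'a metric \<Rightarrow> (('a \<Rightarrow> real) \<Rightarrow> real) \<Rightarrow> bool" where
  "regular_sublinear_expectation_space \<Omega> E \<longleftrightarrow>
     mcomplete_of \<Omega> \<and> separable_space (mtopology_of \<Omega>) \<and>
     (\<forall>X\<in>Cb_Lip \<Omega>. \<forall>Y\<in>Cb_Lip \<Omega>. (\<forall>\<omega>\<in>mspace \<Omega>. X \<omega> \<le> Y \<omega>) \<longrightarrow> E X \<le> E Y) \<and>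
     (\<forall>c. E (\<lambda>\<omega>. c) = c) \<and>
     (\<forall>X\<in>Cb_Lip \<Omega>. \<forall>Y\<in>Cb_Lip \<Omega>. E (\<lambda>\<omega>. X \<omega> + Y \<omega>) \<le> E X + E Y) \<and>
     (\<forall>X\<in>Cb_Lip \<Omega>. \<forall>c\<ge>0. E (\<lambda>\<omega>. c * X \<omega>) = c * E X) \<and>
     (\<forall>X :: nat \<Rightarrow> 'a \<Rightarrow> real.
        (\<forall>k. X k \<in> Cb_Lip \<Omega>) \<and>
        (\<forall>\<omega>\<in>mspace \<Omega>. decseq (\<lambda>k. X k \<omega>) \<and> (\<lambda>k. X k \<omega>) \<longlonglongrightarrow> 0) \<longrightarrow>
        decseq (\<lambda>k. E (X k)) \<and> (\<lambda>k. E (X k)) \<longlonglongrightarrow> 0)"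

definition Borel_of :: "'a metric \<Rightarrow> 'a measure" where
  "Borel_of \<Omega> = sigma (mspace \<Omega>) {U. openin (mtopology_of \<Omega>) U}"

definition prob_measures :: "'a metric \<Rightarrow> 'a measure set" where
  "prob_measures \<Omega> = {P. prob_space P \<and> sets P = sets (Borel_of \<Omega>)}"

text \<open>The coarsest topology for which integration of every bounded continuous function is
  continuous.\<close>

definition weak_topology :: "'a metric \<Rightarrow> 'a measure topology" where
  "weak_topology \<Omega> = topology_generated_by
     {{P \<in> prob_measures \<Omega>. (\<integral>\<omega>. f \<omega> \<partial>P) \<in> U} | f U.
        continuous_map (mtopology_of \<Omega>) euclideanreal f \<and> bounded (f ` mspace \<Omega>) \<and> open U}"

text \<open>Here \<^term>\<open>R\<close> is the mixture of \<^term>\<open>P\<close> and \<^term>\<open>Q\<close> with weights \<^term>\<open>u\<close> and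
  \<^term>\<open>1 - u\<close>, which always exists.\<close>

definition convex_measures :: "'a metric \<Rightarrow> 'a measure set \<Rightarrow> bool" where
  "convex_measures \<Omega> \<P> \<longleftrightarrow>
     (\<forall>P\<in>\<P>. \<forall>Q\<in>\<P>. \<forall>u\<in>{0..1::real}. \<forall>R\<in>prob_measures \<Omega>.
        (\<forall>A\<in>sets (Borel_of \<Omega>). measure R A = u * measure P A + (1 - u) * measure Q A)
          \<longrightarrow> R \<in> \<P>)"

definition representing_set ::
    "'a metric \<Rightarrow> (('a \<Rightarrow> real) \<Rightarrow> real) \<Rightarrow> 'a measure set \<Rightarrow> bool" where
  "representing_set \<Omega> E \<P> \<longleftrightarrow>
     \<P> \<noteq> {} \<and> \<P> \<subseteq> prob_measures \<Omega> \<and> convex_measures \<Omega> \<P> \<and> compactin (weak_topology \<Omega>) \<P> \<and>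
     (\<forall>X\<in>Cb_Lip \<Omega>. E X = (SUP P\<in>\<P>. \<integral>\<omega>. X \<omega> \<partial>P))"

definition upper_capacity :: "'a measure set \<Rightarrow> 'a set \<Rightarrow> real" where
  "upper_capacity \<P> A = (SUP P\<in>\<P>. measure P A)"

text \<open>
  The completion of \<^term>\<open>Cb_Lip \<Omega>\<close> under the norm \<open>(E |X|^p)^(1/p)\<close>, realised by Borel functions.
  By the representation, the norm of a bounded Lipschitz \<open>X\<close> is the \<open>p\<close>-th root of the supremum of
  the integrals of \<open>|X|^p\<close>. Every Cauchy sequence for it has a subsequence that converges outside
  a set of upper capacity zero, so the elements of the completion are the Borel functions that
  are limits of bounded Lipschitz functions in the norm, up to equality outside such a set. The
  integrals are nonnegative extended reals, so an infinite norm cannot be mistaken for a small one;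
  the \<open>p\<close>-th root is irrelevant for convergence to zero.
\<close>

definition Lp :: "'a metric \<Rightarrow> 'a measure set \<Rightarrow> real \<Rightarrow> ('a \<Rightarrow> real) set" where
  "Lp \<Omega> \<P> p = {X \<in> borel_measurable (Borel_of \<Omega>).
     \<exists>Y :: nat \<Rightarrow> 'a \<Rightarrow> real. (\<forall>k. Y k \<in> Cb_Lip \<Omega>) \<and>
       (\<lambda>k. SUP P\<in>\<P>. \<integral>\<^sup>+\<omega>. ennreal (\<bar>X \<omega> - Y k \<omega>\<bar> powr p) \<partial>P) \<longlonglongrightarrow> 0}"

text \<open>The extension of the sublinear expectation, with its representation, to \<open>L^1\<close>. It agrees with
  the given functional on \<^term>\<open>Cb_Lip \<Omega>\<close> by \<^const>\<open>representing_set\<close>, and it is the continuous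
  extension by the lemma \<open>upper_expectation_extends\<close> below.\<close>

definition upper_expectation :: "'a measure set \<Rightarrow> ('a \<Rightarrow> real) \<Rightarrow> real" where
  "upper_expectation \<P> X = (SUP P\<in>\<P>. \<integral>\<omega>. X \<omega> \<partial>P)"

lemma Cb_Lip_integrable:
  assumes "X \<in> Cb_Lip \<Omega>" "P \<in> prob_measures \<Omega>"
  shows "integrable P X"
proof -
  interpret prob_space P using assms by (simp add: prob_measures_def)
  have sP: "sets P = sets (Borel_of \<Omega>)" using assms by (simp add: prob_measures_def)
  have sub: "{U. openin (mtopology_of \<Omega>) U} \<subseteq> Pow (mspace \<Omega>)"
    using openin_subset by fastforce
  have spP: "space P = mspace \<Omega>"
    using sets_eq_imp_space_eq[OF sP] sub by (simp add: Borel_of_def space_measure_of)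
  have "Lipschitz_continuous_map \<Omega> euclidean_metric X"
    using assms(1) by (simp add: Cb_Lip_def)
  from Lipschitz_continuous_imp_continuous_map[OF this]
  have cont: "continuous_map (mtopology_of \<Omega>) euclideanreal X"
    by (simp add: mtopology_of_def)
  have "X \<in> borel_measurable P"
  proof (rule borel_measurableI)
    fix S :: "real set" assume "open S"
    then have "openin (mtopology_of \<Omega>) {x \<in> mspace \<Omega>. X x \<in> S}"
      using cont openin_continuous_map_preimage[of _ _ X S] by fastforce
    moreover have "X -` S \<inter> space P = {x \<in> mspace \<Omega>. X x \<in> S}" using spP by auto
    ultimately show "X -` S \<inter> space P \<in> sets P"
      using sub by (auto simp: sP Borel_of_def)
  qed
  moreover obtain B where "\<And>\<omega>. \<omega> \<in> mspace \<Omega> \<Longrightarrow> norm (X \<omega>) \<le> B"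
    using assms(1) by (auto simp: Cb_Lip_def bounded_iff)
  ultimately show ?thesis
    using spP by (intro integrable_const_bound[of _ B]) auto
qed

lemma upper_expectation_extends:
  assumes P: "representing_set \<Omega> E \<P>" and X: "X \<in> borel_measurable (Borel_of \<Omega>)"
    and Y: "\<And>k. Y k \<in> Cb_Lip \<Omega>"
    and lim: "(\<lambda>k. SUP P\<in>\<P>. \<integral>\<^sup>+\<omega>. ennreal (\<bar>X \<omega> - Y k \<omega>\<bar> powr 1) \<partial>P) \<longlonglongrightarrow> 0"
  shows "(\<lambda>k. E (Y k)) \<longlonglongrightarrow> upper_expectation \<P> X"
proof (rule LIMSEQ_I)
  fix e :: real assume e: "e > 0"
  have ne: "\<P> \<noteq> {}" and pm: "\<And>P. P \<in> \<P> \<Longrightarrow> P \<in> prob_measures \<Omega>"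
    and rep: "\<And>k. E (Y k) = (SUP P\<in>\<P>. \<integral>\<omega>. Y k \<omega> \<partial>P)"
    using P Y by (auto simp: representing_set_def)
  have "eventually (\<lambda>k. (SUP P\<in>\<P>. \<integral>\<^sup>+\<omega>. ennreal (\<bar>X \<omega> - Y k \<omega>\<bar> powr 1) \<partial>P) < ennreal (e/2)) sequentially"
    using order_tendstoD(2)[OF lim] e by simp
  then obtain N where N: "\<And>k. k \<ge> N \<Longrightarrow>
      (SUP P\<in>\<P>. \<integral>\<^sup>+\<omega>. ennreal (\<bar>X \<omega> - Y k \<omega>\<bar> powr 1) \<partial>P) < ennreal (e/2)"
    by (auto simp: eventually_sequentially)
  have "norm (E (Y k) - upper_expectation \<P> X) < e" if k: "k \<ge> N" for k
  proof -
    obtain B where B: "\<And>\<omega>. \<omega> \<in> mspace \<Omega> \<Longrightarrow> \<bar>Y k \<omega>\<bar> \<le> B"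
      using Y[of k] by (auto simp: Cb_Lip_def bounded_iff)
    have each: "\<bar>(\<integral>\<omega>. Y k \<omega> \<partial>P) - (\<integral>\<omega>. X \<omega> \<partial>P)\<bar> \<le> e/2 \<and> \<bar>\<integral>\<omega>. Y k \<omega> \<partial>P\<bar> \<le> B" if "P \<in> \<P>" for P
    proof -
      interpret prob_space P using pm[OF that] by (simp add: prob_measures_def)
      have sP: "sets P = sets (Borel_of \<Omega>)" using pm[OF that] by (simp add: prob_measures_def)
      have sub: "{U. openin (mtopology_of \<Omega>) U} \<subseteq> Pow (mspace \<Omega>)"
        using openin_subset by fastforce
      have spP: "space P = mspace \<Omega>"
        using sets_eq_imp_space_eq[OF sP] sub by (simp add: Borel_of_def space_measure_of)
      have iY: "integrable P (Y k)" using Cb_Lip_integrable[OF Y pm[OF that]] .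
      have mX: "X \<in> borel_measurable P" using X sP measurable_cong_sets by blast
      have *: "(\<integral>\<^sup>+\<omega>. ennreal \<bar>X \<omega> - Y k \<omega>\<bar> \<partial>P) < ennreal (e/2)"
      proof -
        have "(\<integral>\<^sup>+\<omega>. ennreal (\<bar>X \<omega> - Y k \<omega>\<bar> powr 1) \<partial>P) < ennreal (e/2)"
          by (rule le_less_trans[OF SUP_upper[OF that] N[OF k]])
        then show ?thesis by simp
      qed
      have iD: "integrable P (\<lambda>\<omega>. X \<omega> - Y k \<omega>)"
        using * mX iY by (intro integrableI_bounded) (auto simp: less_top[symmetric] top_unique)
      have iX: "integrable P X" using Bochner_Integration.integrable_add[OF iD iY] by simp
      have "ennreal (\<integral>\<omega>. \<bar>X \<omega> - Y k \<omega>\<bar> \<partial>P) < ennreal (e/2)"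
        using * iD by (subst nn_integral_eq_integral[symmetric]) auto
      then have "(\<integral>\<omega>. \<bar>X \<omega> - Y k \<omega>\<bar> \<partial>P) < e/2" using e by (simp add: ennreal_less_iff)
      moreover have "\<bar>\<integral>\<omega>. X \<omega> - Y k \<omega> \<partial>P\<bar> \<le> (\<integral>\<omega>. \<bar>X \<omega> - Y k \<omega>\<bar> \<partial>P)"
        by (rule integral_abs_bound)
      moreover have "(\<integral>\<omega>. X \<omega> - Y k \<omega> \<partial>P) = (\<integral>\<omega>. X \<omega> \<partial>P) - (\<integral>\<omega>. Y k \<omega> \<partial>P)"
        using iX iY by simp
      moreover have "\<bar>\<integral>\<omega>. Y k \<omega> \<partial>P\<bar> \<le> B"
      proof -
        have "\<bar>\<integral>\<omega>. Y k \<omega> \<partial>P\<bar> \<le> (\<integral>\<omega>. \<bar>Y k \<omega>\<bar> \<partial>P)" by (rule integral_abs_bound)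
        also have "\<dots> \<le> B" using iY B spP by (intro integral_le_const) auto
        finally show ?thesis .
      qed
      ultimately show ?thesis by linarith
    qed
    have "bdd_above ((\<lambda>P. \<integral>\<omega>. Y k \<omega> \<partial>P) ` \<P>)"
      using each by (intro bdd_aboveI2[of _ _ B]) (auto simp: abs_le_iff)
    moreover have "bdd_above ((\<lambda>P. \<integral>\<omega>. X \<omega> \<partial>P) ` \<P>)"
      using each by (intro bdd_aboveI2[of _ _ "B + e/2"]) (smt (verit))
    ultimately have up: "\<And>P. P \<in> \<P> \<Longrightarrow> (\<integral>\<omega>. Y k \<omega> \<partial>P) \<le> E (Y k)"
        "\<And>P. P \<in> \<P> \<Longrightarrow> (\<integral>\<omega>. X \<omega> \<partial>P) \<le> upper_expectation \<P> X"
      unfolding rep upper_expectation_def by (auto intro: cSUP_upper)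
    have "upper_expectation \<P> X \<le> E (Y k) + e/2"
      unfolding upper_expectation_def using ne
    proof (rule cSUP_least)
      fix P assume "P \<in> \<P>"
      then show "(\<integral>\<omega>. X \<omega> \<partial>P) \<le> E (Y k) + e/2" using each[of P] up(1)[of P] by linarith
    qed
    moreover have "E (Y k) \<le> upper_expectation \<P> X + e/2"
      unfolding rep using ne
    proof (rule cSUP_least)
      fix P assume "P \<in> \<P>"
      then show "(\<integral>\<omega>. Y k \<omega> \<partial>P) \<le> upper_expectation \<P> X + e/2"
        using each[of P] up(2)[of P] by linarith
    qed
    ultimately have "upper_expectation \<P> X \<le> E (Y k) + e/2"
      "E (Y k) \<le> upper_expectation \<P> X + e/2" by auto
    then show ?thesis using e by (simp add: abs_if)
  qed
  then show "\<exists>N. \<forall>k\<ge>N. norm (E (Y k) - upper_expectation \<P> X) < e" by blast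
qed

text \<open>Bounded Lipschitz functions on \<open>\<real>^m\<close> with coordinates \<open>1, \<dots>, m\<close> and the Euclidean norm; the
  Lipschitz condition makes the function depend on these coordinates only.\<close>

definition bLip :: "nat \<Rightarrow> ((nat \<Rightarrow> real) \<Rightarrow> real) set" where
  "bLip m = {\<psi>. bounded (range \<psi>) \<and>
     (\<exists>L. \<forall>x y. \<bar>\<psi> x - \<psi> y\<bar> \<le> L * L2_set (\<lambda>j. x j - y j) {1..m})}"

definition independent_under :: "'a measure set \<Rightarrow> nat \<Rightarrow> (nat \<Rightarrow> 'a \<Rightarrow> real) \<Rightarrow> bool" where
  "independent_under \<P> n X \<longleftrightarrow>
     (\<forall>i. 1 \<le> i \<and> i < n \<longrightarrow> (\<forall>\<psi>\<in>bLip (i + 1).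
        upper_expectation \<P> (\<lambda>\<omega>. \<psi> (\<lambda>j. X j \<omega>)) =
        upper_expectation \<P> (\<lambda>\<omega>.
          upper_expectation \<P> (\<lambda>\<omega>'. \<psi> ((\<lambda>j. X j \<omega>)(i + 1 := X (i + 1) \<omega>'))))))"

definition mean_set :: "'a measure set \<Rightarrow> ('a \<Rightarrow> real) \<Rightarrow> real set" where
  "mean_set \<P> X = {\<theta>. \<forall>p. \<theta> * p \<le> upper_expectation \<P> (\<lambda>\<omega>. p * X \<omega>)}"

definition average_mean_set :: "'a measure set \<Rightarrow> nat \<Rightarrow> (nat \<Rightarrow> 'a \<Rightarrow> real) \<Rightarrow> real set" where
  "average_mean_set \<P> n X = {(\<Sum>i=1..n. \<theta> i) / real n | \<theta>. \<forall>i\<in>{1..n}. \<theta> i \<in> mean_set \<P> (X i)}"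

text \<open>
  An existence claim over all complete separable metric spaces can be stated over
  \<^typ>\<open>real metric\<close>: a separable metric space has at most the cardinality of the continuum, so
  it is isometric to one whose carrier is a set of reals with a suitable metric, in general
  unrelated to the usual distance.
\<close>

end

theory Submission
  imports Defs
begin

text \<open>
  The right-hand side is at most \<open>1/4\<close> and \<open>t < \<sigma>\<close>, so it is enough that some probability measure
  gives mass at least \<open>1/4\<close> to the event that the average equals \<open>a + \<sigma>\<close>, which has distance
  \<open>\<sigma>\<close> from \<open>[-a, a]\<close>. Let each \<open>X\<^sub>i\<close> take the
  values \<open>a + \<sigma>\<close> and \<open>- (a + 2n\<sigma>)\<close>, the conditional probability of the high value given the past
  ranging over the interval for which the conditional mean ranges over \<open>[-a, a]\<close>. The largest
  probability \<open>q\<close> of the high value satisfies \<open>1 - q \<le> 1/(2n)\<close>, so all variables are high with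
  probability \<open>q^n \<ge> 1/2\<close> under the corresponding product measure. Since the conditional
  probabilities are constrained separately at each step, the last coordinate of a function of the
  first \<open>i + 1\<close> coordinates can be optimised on its own, which is independence.
\<close>

subsection \<open>Sublinear expectations on finite discrete spaces\<close>

definition discrete_space :: "'a set \<Rightarrow> 'a metric" where
  "discrete_space S = metric (S, discrete_metric.dd)"

lemma mspace_discrete_space [simp]: "mspace (discrete_space S) = S"
  by (simp add: discrete_space_def Metric_space.mspace_metric metric_M_dd)

lemma mdist_discrete_space [simp]: "mdist (discrete_space S) x y = (if x = y then 0 else 1)"
  by (metis Metric_space.mdist_metric metric_M_dd discrete_metric.dd_def discrete_space_def)

lemma mtopology_of_discrete_space [simp]: "mtopology_of (discrete_space S) = discrete_topology S"
  by (simp add: discrete_space_def Metric_space.mtopology_of metric_M_dd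
      discrete_metric.mtopology_discrete_metric)

lemma mcomplete_of_discrete_space: "mcomplete_of (discrete_space S)"
  by (simp add: discrete_space_def Metric_space.mcomplete_of metric_M_dd
      discrete_metric.mcomplete_discrete_metric)

lemma sets_Borel_of_discrete_space [simp]: "sets (Borel_of (discrete_space S)) = Pow S"
proof -
  have "{U. U \<subseteq> S} = Pow S" by auto
  then show ?thesis
    by (simp add: Borel_of_def sigma_algebra.sigma_sets_eq sigma_algebra_Pow)
qed

lemma space_Borel_of_discrete_space [simp]: "space (Borel_of (discrete_space S)) = S"
  by (simp add: Borel_of_def space_measure_of_conv)

text \<open>Distinct points have distance 1, so twice a bound for \<open>X\<close> is a Lipschitz
  constant. Membership in \<open>Cb_Lip\<close> is thus automatic on a finite carrier.\<close>

lemma Cb_Lip_discrete_space: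
  assumes "finite S"
  shows "X \<in> Cb_Lip (discrete_space S)"
proof -
  define B where "B = (\<Sum>x\<in>S. \<bar>X x\<bar>)"
  have B: "\<bar>X x\<bar> \<le> B" if "x \<in> S" for x
    unfolding B_def using assms that by (intro member_le_sum) auto
  have "\<bar>X x - X y\<bar> \<le> 2 * B" if "x \<in> S" "y \<in> S" for x y
    using B[OF that(1)] B[OF that(2)] by linarith
  then have "Lipschitz_continuous_map (discrete_space S) euclidean_metric X"
    unfolding Lipschitz_continuous_map_def
    by (auto simp: dist_real_def intro!: exI[of _ "2 * B"])
  then show ?thesis
    using assms by (simp add: Cb_Lip_def finite_imp_bounded)
qed

section \<open>Laws on a finite carrier given by a compact convex set of weights\<close>

locale weight_model =
  fixes T :: "'b set" and g :: "'b \<Rightarrow> 'a" and K :: "('b \<Rightarrow> real) set"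
  assumes finite_T: "finite T" and inj_g: "inj_on g T"
    and K_nonempty: "K \<noteq> {}"
    and nonneg: "\<And>w A. w \<in> K \<Longrightarrow> A \<in> T \<Longrightarrow> 0 \<le> w A"
    and total: "\<And>w. w \<in> K \<Longrightarrow> (\<Sum>A\<in>T. w A) = 1"
    and mix: "\<And>w v u. w \<in> K \<Longrightarrow> v \<in> K \<Longrightarrow> 0 \<le> u \<Longrightarrow> u \<le> 1 \<Longrightarrow>
                (\<lambda>A. u * w A + (1 - u) * v A) \<in> K"
    and compact_K: "compact K"
begin

text \<open>The index set \<open>T\<close> is transported to the carrier by \<open>g\<close>, so
  that the combinatorics can be done on \<open>T\<close> whatever type the carrier has.\<close>

definition law :: "('b \<Rightarrow> real) \<Rightarrow> 'a measure" where
  "law w = point_measure (g ` T) (\<lambda>x. ennreal (w (inv_into T g x)))"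

abbreviation \<Omega> :: "'a metric" where "\<Omega> \<equiv> discrete_space (g ` T)"

abbreviation laws :: "'a measure set" where "laws \<equiv> law ` K"

lemma integral_law:
  fixes f :: "'a \<Rightarrow> real"
  assumes "w \<in> K"
  shows "(\<integral>\<omega>. f \<omega> \<partial>law w) = (\<Sum>A\<in>T. w A * f (g A))"
proof -
  have "(\<integral>\<omega>. f \<omega> \<partial>law w) = (\<Sum>x\<in>g ` T. w (inv_into T g x) * f x)"
    unfolding law_def using finite_T assms nonneg inj_g
    by (subst lebesgue_integral_point_measure_finite) auto
  then show ?thesis using inj_g by (simp add: sum.reindex)
qed

lemma sets_law [simp]: "sets (law w) = Pow (g ` T)" and space_law [simp]: "space (law w) = g ` T"
  by (simp_all add: law_def sets_point_measure space_point_measure)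

lemma measure_law:
  assumes "w \<in> K" "B \<subseteq> g ` T"
  shows "measure (law w) B = (\<Sum>x\<in>B. w (inv_into T g x))"
  unfolding law_def using finite_T assms nonneg inj_g
  by (subst measure_point_measure_finite_if) auto

lemma measure_law_singleton:
  assumes "w \<in> K" "A \<in> T"
  shows "measure (law w) {g A} = w A"
  using assms inj_g by (simp add: measure_law)

lemma law_in_prob_measures:
  assumes "w \<in> K"
  shows "law w \<in> prob_measures \<Omega>"
proof -
  have "emeasure (law w) (g ` T) = ennreal (\<Sum>x\<in>g ` T. w (inv_into T g x))"
    unfolding law_def using finite_T assms nonneg inj_g
    by (subst emeasure_point_measure_finite) (auto intro!: sum_ennreal)
  also have "\<dots> = 1" using total[OF assms] inj_g by (simp add: sum.reindex)
  finally show ?thesis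
    by (auto simp: prob_measures_def intro!: prob_spaceI)
qed

lemma upper_expectation_laws:
  "upper_expectation laws f = (SUP w\<in>K. \<Sum>A\<in>T. w A * f (g A))"
  unfolding upper_expectation_def by (simp add: image_image integral_law cong: image_cong)

text \<open>Nonnegative weights with sum 1 are at most 1. The bound is uniform in \<open>w\<close>,
  which keeps the real-valued suprema over \<open>K\<close> finite and later gives continuity at
  zero.\<close>

lemma abs_expectation_le:
  assumes "w \<in> K"
  shows "\<bar>\<Sum>A\<in>T. w A * f A\<bar> \<le> (\<Sum>A\<in>T. \<bar>f A\<bar>)"
proof -
  have "w A \<le> 1" if "A \<in> T" for A
    using member_le_sum[of A T w] that finite_T nonneg[OF assms] total[OF assms] by auto
  then have "\<bar>w A * f A\<bar> \<le> \<bar>f A\<bar>" if "A \<in> T" for A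
    using that nonneg[OF assms that] by (simp add: abs_mult mult_left_le_one_le)
  then show ?thesis
    by (intro order_trans[OF sum_abs sum_mono])
qed

lemma bdd_above_expectation: "bdd_above ((\<lambda>w. \<Sum>A\<in>T. w A * f A) ` K)"
  by (rule bdd_aboveI2) (rule abs_le_D1[OF abs_expectation_le])

lemma expectation_le_upper:
  assumes "w \<in> K"
  shows "(\<Sum>A\<in>T. w A * f (g A)) \<le> upper_expectation laws f"
  unfolding upper_expectation_laws using bdd_above_expectation assms by (intro cSUP_upper)

lemma upper_expectation_leI:
  assumes "\<And>w. w \<in> K \<Longrightarrow> (\<Sum>A\<in>T. w A * f (g A)) \<le> c"
  shows "upper_expectation laws f \<le> c"
  unfolding upper_expectation_laws using K_nonempty assms by (intro cSUP_least)

lemma upper_expectation_mono: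
  assumes "\<And>A. A \<in> T \<Longrightarrow> f (g A) \<le> h (g A)"
  shows "upper_expectation laws f \<le> upper_expectation laws h"
proof (rule upper_expectation_leI)
  fix w assume w: "w \<in> K"
  have "(\<Sum>A\<in>T. w A * f (g A)) \<le> (\<Sum>A\<in>T. w A * h (g A))"
    using assms nonneg[OF w] by (intro sum_mono mult_left_mono) auto
  then show "(\<Sum>A\<in>T. w A * f (g A)) \<le> upper_expectation laws h"
    using expectation_le_upper[OF w] by (rule order_trans)
qed

lemma upper_expectation_const: "upper_expectation laws (\<lambda>\<omega>. c) = c"
  using total K_nonempty by (simp add: upper_expectation_laws flip: sum_distrib_right)

lemma regular_sublinear_expectation_space_laws:
  "regular_sublinear_expectation_space \<Omega> (upper_expectation laws)"
  unfolding regular_sublinear_expectation_space_def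
proof (intro conjI allI ballI impI)
  show "mcomplete_of \<Omega>" by (rule mcomplete_of_discrete_space)
  show "separable_space (mtopology_of \<Omega>)"
    using finite_T closure_of_topspace[of "discrete_topology (g ` T)"]
    by (auto simp: separable_space_def simp del: closure_of_topspace
        intro!: exI[of _ "g ` T"] countable_finite)
  show "upper_expectation laws X \<le> upper_expectation laws Y"
    if "\<forall>\<omega>\<in>mspace \<Omega>. X \<omega> \<le> Y \<omega>" for X Y
    using that by (intro upper_expectation_mono) auto
  show "upper_expectation laws (\<lambda>\<omega>. c) = c" for c by (rule upper_expectation_const)
  show "upper_expectation laws (\<lambda>\<omega>. X \<omega> + Y \<omega>)
      \<le> upper_expectation laws X + upper_expectation laws Y" for X Y
    using expectation_le_upper
    by (intro upper_expectation_leI) (simp add: distrib_left sum.distrib add_mono)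
  show "upper_expectation laws (\<lambda>\<omega>. c * X \<omega>) = c * upper_expectation laws X"
    if "0 \<le> c" for X c
  proof (cases "c = 0")
    case True
    then show ?thesis by (simp add: upper_expectation_const)
  next
    case False
    \<comment> \<open>Only this inequality is immediate; applied to \<open>inverse c\<close> and the
      function \<open>c * X\<close> it gives the reverse one.\<close>
    have le: "upper_expectation laws (\<lambda>\<omega>. c * Y \<omega>) \<le> c * upper_expectation laws Y"
      if "0 \<le> c" for c Y
    proof (rule upper_expectation_leI)
      fix w assume w: "w \<in> K"
      have "(\<Sum>A\<in>T. w A * (c * Y (g A))) = c * (\<Sum>A\<in>T. w A * Y (g A))"
        by (simp add: sum_distrib_left mult_ac)
      then show "(\<Sum>A\<in>T. w A * (c * Y (g A))) \<le> c * upper_expectation laws Y"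
        using expectation_le_upper[OF w] that by (simp add: mult_left_mono)
    qed
    have "upper_expectation laws X \<le> inverse c * upper_expectation laws (\<lambda>\<omega>. c * X \<omega>)"
      using le[of "inverse c" "\<lambda>\<omega>. c * X \<omega>"] that False by (simp flip: mult.assoc)
    then have "c * upper_expectation laws X \<le> upper_expectation laws (\<lambda>\<omega>. c * X \<omega>)"
      using that False by (simp add: field_simps)
    then show ?thesis using le[OF that, of X] by simp
  qed
next
  fix X :: "nat \<Rightarrow> 'a \<Rightarrow> real"
  assume X: "(\<forall>k. X k \<in> Cb_Lip \<Omega>) \<and>
    (\<forall>\<omega>\<in>mspace \<Omega>. decseq (\<lambda>k. X k \<omega>) \<and> (\<lambda>k. X k \<omega>) \<longlonglongrightarrow> 0)"
  show "decseq (\<lambda>k. upper_expectation laws (X k))"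
    using X by (auto simp: decseq_def intro!: upper_expectation_mono)
  show "(\<lambda>k. upper_expectation laws (X k)) \<longlonglongrightarrow> 0"
  proof (rule Lim_null_comparison)
    \<comment> \<open>Finiteness of \<open>T\<close> turns pointwise convergence into convergence of
      a sum that dominates all expectations at once.\<close>
    have "norm (upper_expectation laws (X k)) \<le> (\<Sum>A\<in>T. \<bar>X k (g A)\<bar>)" for k
    proof -
      obtain w where w: "w \<in> K" using K_nonempty by blast
      have "- (\<Sum>A\<in>T. \<bar>X k (g A)\<bar>) \<le> upper_expectation laws (X k)"
        using abs_expectation_le[OF w, of "\<lambda>A. X k (g A)"] expectation_le_upper[OF w, of "X k"]
        by linarith
      moreover have "upper_expectation laws (X k) \<le> (\<Sum>A\<in>T. \<bar>X k (g A)\<bar>)"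
        using abs_expectation_le[of _ "\<lambda>A. X k (g A)"]
        by (intro upper_expectation_leI) (simp add: abs_le_iff)
      ultimately show ?thesis by simp
    qed
    then show "\<forall>\<^sub>F k in sequentially. norm (upper_expectation laws (X k)) \<le> (\<Sum>A\<in>T. \<bar>X k (g A)\<bar>)"
      by simp
    have "(\<lambda>k. \<Sum>A\<in>T. \<bar>X k (g A)\<bar>) \<longlonglongrightarrow> (\<Sum>A\<in>T. \<bar>0\<bar>)"
      using X by (intro tendsto_sum tendsto_rabs) auto
    then show "(\<lambda>k. \<Sum>A\<in>T. \<bar>X k (g A)\<bar>) \<longlonglongrightarrow> 0" by simp
  qed
qed

text \<open>Integrals against \<open>law w\<close> are finite sums, hence continuous in
  \<open>w\<close>. So \<open>law\<close> is continuous into the weak topology and maps the compact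
  set \<open>K\<close> to a compact set.\<close>

lemma compactin_weak_topology_laws: "compactin (weak_topology \<Omega>) laws"
proof (rule image_compactin)
  show "compactin (top_of_set K) K"
    using compact_K by (simp add: compactin_subtopology)
  show "continuous_map (top_of_set K) (weak_topology \<Omega>) law"
    unfolding weak_topology_def
  proof (rule continuous_on_generated_topo)
    fix V
    assume "V \<in> {{P \<in> prob_measures \<Omega>. (\<integral>\<omega>. f \<omega> \<partial>P) \<in> U} | f U.
        continuous_map (mtopology_of \<Omega>) euclideanreal f \<and> bounded (f ` mspace \<Omega>) \<and> open U}"
    then obtain f :: "'a \<Rightarrow> real" and U
      where V: "V = {P \<in> prob_measures \<Omega>. (\<integral>\<omega>. f \<omega> \<partial>P) \<in> U}" and U: "open U"
      by auto
    have eq: "law -` V \<inter> topspace (top_of_set K) = K \<inter> (\<lambda>w. \<Sum>A\<in>T. w A * f (g A)) -` U"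
      by (auto simp: V integral_law law_in_prob_measures)
    have "continuous_on K (\<lambda>w. \<Sum>A\<in>T. w A * f (g A))"
      by (intro continuous_intros continuous_on_subset[OF continuous_on_product_coordinates]) auto
    then show "openin (top_of_set K) (law -` V \<inter> topspace (top_of_set K))"
      unfolding eq using U by (rule continuous_openin_preimage_gen)
  next
    \<comment> \<open>With \<open>f = 0\<close> and \<open>U = UNIV\<close> the subbasic set is all
      of \<open>prob_measures \<Omega>\<close>, so every \<open>law w\<close> is a point of the
      generated topology.\<close>
    have "prob_measures \<Omega> \<in> {{P \<in> prob_measures \<Omega>. (\<integral>\<omega>. f \<omega> \<partial>P) \<in> U} | f U.
        continuous_map (mtopology_of \<Omega>) euclideanreal f \<and> bounded (f ` mspace \<Omega>) \<and> open U}"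
      using finite_T by (intro CollectI exI[of _ "\<lambda>_. 0"] exI[of _ UNIV]) auto
    then show "law ` topspace (top_of_set K) \<subseteq>
      \<Union>{{P \<in> prob_measures \<Omega>. (\<integral>\<omega>. f \<omega> \<partial>P) \<in> U} | f U.
        continuous_map (mtopology_of \<Omega>) euclideanreal f \<and> bounded (f ` mspace \<Omega>) \<and> open U}"
      by - (erule order_trans[OF _ Union_upper, rotated], simp add: image_subset_iff law_in_prob_measures)
  qed
qed

text \<open>The mixture of two laws has the same values on all subsets of the carrier as the law of
  the mixed weights.\<close>

lemma convex_measures_laws: "convex_measures \<Omega> laws"
  unfolding convex_measures_def
proof (intro ballI impI)
  fix P Q u R
  assume "P \<in> laws" "Q \<in> laws" and u: "u \<in> {0..1::real}" and R: "R \<in> prob_measures \<Omega>"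
    and eq: "\<forall>A\<in>sets (Borel_of \<Omega>). measure R A = u * measure P A + (1 - u) * measure Q A"
  then obtain w v where w: "w \<in> K" "P = law w" and v: "v \<in> K" "Q = law v" by blast
  let ?z = "\<lambda>A. u * w A + (1 - u) * v A"
  have z: "?z \<in> K" using mix w v u by auto
  interpret R: prob_space R using R by (simp add: prob_measures_def)
  interpret Z: prob_space "law ?z" using law_in_prob_measures[OF z] by (simp add: prob_measures_def)
  have "R = law ?z"
  proof (rule measure_eqI)
    show s: "sets R = sets (law ?z)" using R by (simp add: prob_measures_def)
    fix B assume "B \<in> sets R"
    then have B: "B \<subseteq> g ` T" using s by simp
    then have "measure R B = measure (law ?z) B"
      using eq w v z by (simp add: measure_law sum.distrib sum_distrib_left)
    then show "emeasure R B = emeasure (law ?z) B"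
      by (simp add: R.emeasure_eq_measure Z.emeasure_eq_measure)
  qed
  then show "R \<in> laws" using z by blast
qed

lemma representing_set_laws: "representing_set \<Omega> (upper_expectation laws) laws"
  unfolding representing_set_def
  using K_nonempty law_in_prob_measures convex_measures_laws compactin_weak_topology_laws
  by (auto simp: upper_expectation_def)

text \<open>On a finite discrete carrier \<open>X\<close> is itself Borel and bounded Lipschitz, so
  the constant sequence \<open>X\<close> approximates it.\<close>

lemma in_Lp_laws:
  assumes "0 < p"
  shows "X \<in> Lp \<Omega> laws p"
proof -
  have "X \<in> borel_measurable (Borel_of \<Omega>)"
    by (auto simp: measurable_def)
  moreover have "(SUP P\<in>laws. \<integral>\<^sup>+\<omega>. ennreal (\<bar>X \<omega> - X \<omega>\<bar> powr p) \<partial>P) = 0"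
    using K_nonempty by simp
  ultimately show ?thesis
    using Cb_Lip_discrete_space[of "g ` T" X] finite_T
    by (auto simp: Lp_def intro!: exI[of _ "\<lambda>_. X"])
qed

lemma weight_le_upper_capacity:
  assumes "w \<in> K" "A \<in> T" "g A \<in> B" "B \<subseteq> g ` T"
  shows "w A \<le> upper_capacity laws B"
proof -
  have le1: "measure (law w) B \<le> 1" if "w \<in> K" for w
  proof -
    interpret prob_space "law w" using law_in_prob_measures[OF that] by (simp add: prob_measures_def)
    show ?thesis by simp
  qed
  have "w A \<le> measure (law w) B"
  proof -
    interpret prob_space "law w"
      using law_in_prob_measures[OF assms(1)] by (simp add: prob_measures_def)
    have "measure (law w) {g A} \<le> measure (law w) B"
      using assms by (intro finite_measure_mono) auto
    then show ?thesis using measure_law_singleton assms by simp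
  qed
  also have "\<dots> \<le> upper_capacity laws B"
    unfolding upper_capacity_def using assms le1
    by (intro cSUP_upper bdd_aboveI2[of _ _ 1]) auto
  finally show ?thesis .
qed

end

subsection \<open>Weights with constrained conditional probabilities\<close>

text \<open>A configuration is encoded as the set \<open>A\<close> of coordinates that take the high
  value; a weight on such sets is a joint law.\<close>

definition expect :: "nat \<Rightarrow> (nat set \<Rightarrow> real) \<Rightarrow> (nat set \<Rightarrow> real) \<Rightarrow> real" where
  "expect n w f = (\<Sum>A\<in>Pow {1..n}. w A * f A)"

text \<open>Adaptedness: measurability with respect to the coordinates strictly before
  \<open>j\<close>.\<close>

definition depends_below :: "nat \<Rightarrow> (nat set \<Rightarrow> 'c) \<Rightarrow> bool" where
  "depends_below j f \<longleftrightarrow> (\<forall>A B. A \<inter> {..<j} = B \<inter> {..<j} \<longrightarrow> f A = f B)"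

text \<open>The transition operator that redraws coordinate \<open>j\<close>, high with probability
  \<open>k A\<close>, and leaves the others alone. It acts on functions, so \<open>expect\<close> of
  the result is the mean after the redraw.\<close>

definition resample :: "nat \<Rightarrow> (nat set \<Rightarrow> real) \<Rightarrow> (nat set \<Rightarrow> real) \<Rightarrow> nat set \<Rightarrow> real" where
  "resample j k f A = k A * f (insert j A) + (1 - k A) * f (A - {j})"

text \<open>The conditional probability of \<open>j \<in> A\<close> given \<open>A \<inter> {..<j}\<close> lies in \<open>[lo, hi]\<close> for \<open>j \<in> J\<close>.
  Testing against \<open>\<phi>\<close> avoids dividing by the probabilities of histories and makes the constraints
  linear in \<open>w\<close>, hence convex and closed.\<close>

definition biased_weights :: "nat \<Rightarrow> real \<Rightarrow> real \<Rightarrow> nat set \<Rightarrow> (nat set \<Rightarrow> real) set" where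
  "biased_weights n lo hi J = {w. (\<forall>A. 0 \<le> w A) \<and> (\<forall>A. \<not> A \<subseteq> {1..n} \<longrightarrow> w A = 0) \<and>
     expect n w (\<lambda>_. 1) = 1 \<and>
     (\<forall>j\<in>J. \<forall>\<phi>. depends_below j \<phi> \<and> (\<forall>A. 0 \<le> \<phi> A) \<longrightarrow>
        lo * expect n w \<phi> \<le> expect n w (\<lambda>A. of_bool (j \<in> A) * \<phi> A) \<and>
        expect n w (\<lambda>A. of_bool (j \<in> A) * \<phi> A) \<le> hi * expect n w \<phi>)}"

text \<open>Resampling is affine in the probability, so the larger endpoint value is the maximum
  over the whole interval from \<open>lo\<close> to \<open>hi\<close>.\<close>

definition best_response :: "real \<Rightarrow> real \<Rightarrow> nat \<Rightarrow> (nat set \<Rightarrow> real) \<Rightarrow> nat set \<Rightarrow> real" where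
  "best_response lo hi j f A = max (resample j (\<lambda>_. lo) f A) (resample j (\<lambda>_. hi) f A)"

lemma depends_belowD: "depends_below j f \<Longrightarrow> A \<inter> {..<j} = B \<inter> {..<j} \<Longrightarrow> f A = f B"
  unfolding depends_below_def by blast

lemma depends_below_comp: "depends_below j f \<Longrightarrow> depends_below j (\<lambda>A. h (f A))"
  unfolding depends_below_def by metis

lemma depends_below_mono:
  assumes "depends_below i f" "i \<le> j"
  shows "depends_below j f"
  unfolding depends_below_def
proof (intro allI impI)
  fix A B :: "nat set"
  assume "A \<inter> {..<j} = B \<inter> {..<j}"
  then have "A \<inter> {..<j} \<inter> {..<i} = B \<inter> {..<j} \<inter> {..<i}" by simp
  moreover have "{..<j} \<inter> {..<i} = {..<i}" using assms(2) by auto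
  ultimately have "A \<inter> {..<i} = B \<inter> {..<i}" by (simp add: Int_assoc)
  then show "f A = f B" by (rule depends_belowD[OF assms(1)])
qed

lemma depends_below_insert_remove:
  assumes "depends_below j f"
  shows "f (insert j A) = f A" "f (A - {j}) = f A"
  by (rule depends_belowD[OF assms]; auto)+

lemma depends_below_resample:
  assumes "depends_below l f" "depends_below l k"
  shows "depends_below l (resample j k f)"
  unfolding depends_below_def resample_def
proof (intro allI impI)
  fix A B assume AB: "A \<inter> {..<l} = B \<inter> {..<l}"
  have "f (insert j A) = f (insert j B)" "f (A - {j}) = f (B - {j})" "k A = k B"
    using AB by (auto intro!: depends_belowD[OF assms(1)] depends_belowD[OF assms(2)])
  then show "k A * f (insert j A) + (1 - k A) * f (A - {j}) =
      k B * f (insert j B) + (1 - k B) * f (B - {j})" by simp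
qed

lemma resample_depends_below:
  assumes "depends_below j f"
  shows "resample j k f = f"
  by (rule ext) (simp add: resample_def depends_below_insert_remove[OF assms] algebra_simps)

lemma resample_nonneg:
  assumes "\<And>A. 0 \<le> f A" "0 \<le> k A" "k A \<le> 1"
  shows "0 \<le> resample j k f A"
  using assms by (simp add: resample_def)

lemma expect_add: "expect n w (\<lambda>A. f A + h A) = expect n w f + expect n w h"
  by (simp add: expect_def distrib_left sum.distrib)

lemma expect_diff: "expect n w (\<lambda>A. f A - h A) = expect n w f - expect n w h"
  by (simp add: expect_def right_diff_distrib sum_subtractf)

lemma expect_cmult: "expect n w (\<lambda>A. c * f A) = c * expect n w f"
  by (simp add: expect_def sum_distrib_left mult_ac)

lemma expect_cong:
  "(\<And>A. A \<subseteq> {1..n} \<Longrightarrow> f A = h A) \<Longrightarrow> expect n w f = expect n w h"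
  by (auto simp: expect_def intro!: sum.cong)

lemma expect_mono:
  assumes "\<And>A. 0 \<le> w A" "\<And>A. A \<subseteq> {1..n} \<Longrightarrow> f A \<le> h A"
  shows "expect n w f \<le> expect n w h"
  using assms by (auto simp: expect_def intro!: sum_mono mult_left_mono)

lemma biased_weightsD:
  assumes "w \<in> biased_weights n lo hi J"
  shows "0 \<le> w A" "\<not> A \<subseteq> {1..n} \<Longrightarrow> w A = 0" "expect n w (\<lambda>_. c) = c"
    and "j \<in> J \<Longrightarrow> depends_below j \<phi> \<Longrightarrow> (\<And>A. 0 \<le> \<phi> A) \<Longrightarrow>
           lo * expect n w \<phi> \<le> expect n w (\<lambda>A. of_bool (j \<in> A) * \<phi> A)"
    and "j \<in> J \<Longrightarrow> depends_below j \<phi> \<Longrightarrow> (\<And>A. 0 \<le> \<phi> A) \<Longrightarrow>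
           expect n w (\<lambda>A. of_bool (j \<in> A) * \<phi> A) \<le> hi * expect n w \<phi>"
proof -
  note * = assms[unfolded biased_weights_def mem_Collect_eq]
  show "0 \<le> w A" by (rule *[THEN conjunct1, THEN spec])
  show "w A = 0" if "\<not> A \<subseteq> {1..n}"
    by (rule *[THEN conjunct2, THEN conjunct1, THEN spec, THEN mp, OF that])
  show "expect n w (\<lambda>_. c) = c"
    using expect_cmult[of n w c "\<lambda>_. 1"] *[THEN conjunct2, THEN conjunct2, THEN conjunct1] by simp
  assume "j \<in> J" "depends_below j \<phi>" "\<And>A. 0 \<le> \<phi> A"
  then have "lo * expect n w \<phi> \<le> expect n w (\<lambda>A. of_bool (j \<in> A) * \<phi> A) \<and>
      expect n w (\<lambda>A. of_bool (j \<in> A) * \<phi> A) \<le> hi * expect n w \<phi>"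
    by (intro *[THEN conjunct2, THEN conjunct2, THEN conjunct2, THEN bspec, THEN spec, THEN mp]
        conjI allI)
  then show "lo * expect n w \<phi> \<le> expect n w (\<lambda>A. of_bool (j \<in> A) * \<phi> A)"
    and "expect n w (\<lambda>A. of_bool (j \<in> A) * \<phi> A) \<le> hi * expect n w \<phi>" by auto
qed

section \<open>Redrawing one coordinate\<close>

lemma sum_mult_of_bool_singleton:
  fixes f :: "'c \<Rightarrow> real"
  assumes "finite S" "C \<in> S"
  shows "(\<Sum>B\<in>S. f B * of_bool (C = B)) = f C"
proof -
  have "(\<Sum>B\<in>S. f B * of_bool (C = B)) = (\<Sum>B\<in>S. if B = C then f B else 0)"
    by (intro sum.cong) auto
  then show ?thesis using assms by simp
qed

lemma expect_resample_obtain: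
  assumes w: "\<And>A. 0 \<le> w A" and j: "j \<in> {1..n}" and k: "\<And>A. 0 \<le> k A" "\<And>A. k A \<le> 1"
  obtains w' where "\<And>A. 0 \<le> w' A" "\<And>A. \<not> A \<subseteq> {1..n} \<Longrightarrow> w' A = 0"
    "\<And>f. expect n w' f = expect n w (resample j k f)"
proof
  \<comment> \<open>The new weight of \<open>B\<close> is the mean of the resampled indicator of
    \<open>B\<close>; expanding \<open>f\<close> in indicators gives the formula for every
    \<open>f\<close>.\<close>
  define w' where
    "w' B = (if B \<subseteq> {1..n} then expect n w (resample j k (\<lambda>A. of_bool (A = B))) else 0)" for B
  show "0 \<le> w' A" for A
    using w k by (auto simp: w'_def expect_def intro!: sum_nonneg mult_nonneg_nonneg resample_nonneg)
  show "w' A = 0" if "\<not> A \<subseteq> {1..n}" for A using that by (simp add: w'_def)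
  show "expect n w' f = expect n w (resample j k f)" for f
  proof -
    have eq: "resample j k f A = (\<Sum>B\<in>Pow {1..n}. f B * resample j k (\<lambda>A. of_bool (A = B)) A)"
      if "A \<subseteq> {1..n}" for A
    proof -
      have *: "f (insert j A) = (\<Sum>B\<in>Pow {1..n}. f B * of_bool (insert j A = B))"
        "f (A - {j}) = (\<Sum>B\<in>Pow {1..n}. f B * of_bool (A - {j} = B))"
        using that j by (subst sum_mult_of_bool_singleton; auto)+
      have "(\<Sum>B\<in>Pow {1..n}. f B * resample j k (\<lambda>A. of_bool (A = B)) A) =
          (\<Sum>B\<in>Pow {1..n}. k A * (f B * of_bool (insert j A = B)) +
            (1 - k A) * (f B * of_bool (A - {j} = B)))"
        by (intro sum.cong) (auto simp: resample_def algebra_simps)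
      then show ?thesis
        unfolding resample_def by (simp only: * sum.distrib sum_distrib_left)
    qed
    have "expect n w' f =
        (\<Sum>B\<in>Pow {1..n}. \<Sum>A\<in>Pow {1..n}. w A * (f B * resample j k (\<lambda>A. of_bool (A = B)) A))"
      unfolding expect_def w'_def by (intro sum.cong) (auto simp: expect_def sum_distrib_left mult_ac)
    also have "\<dots> = expect n w (resample j k f)"
      unfolding expect_def by (subst sum.swap) (auto simp: eq sum_distrib_left intro!: sum.cong)
    finally show ?thesis .
  qed
qed

text \<open>Redrawing coordinate \<open>j\<close> by an adapted kernel also keeps the constraints at later coordinates
  \<open>l\<close>, because resampling turns a test function of the coordinates below \<open>l\<close> into another one.\<close>

lemma biased_weights_resample:
  assumes w: "w \<in> biased_weights n lo hi J" and j: "j \<in> {1..n}"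
    and lohi: "0 \<le> lo" "hi \<le> 1"
    and k: "depends_below j k" "\<And>A. lo \<le> k A" "\<And>A. k A \<le> hi"
  obtains w' where "w' \<in> biased_weights n lo hi (insert j J)"
    "\<And>f. expect n w' f = expect n w (resample j k f)"
proof -
  have k01: "0 \<le> k A" "k A \<le> 1" for A using lohi k(2,3)[of A] by linarith+
  obtain w' where w': "\<And>A. 0 \<le> w' A" "\<And>A. \<not> A \<subseteq> {1..n} \<Longrightarrow> w' A = 0"
    "\<And>f. expect n w' f = expect n w (resample j k f)"
    by (rule expect_resample_obtain[of w j n k, OF biased_weightsD(1)[OF w] j k01]) (rule that)
  have "lo * expect n w' \<phi> \<le> expect n w' (\<lambda>A. of_bool (l \<in> A) * \<phi> A) \<and>
      expect n w' (\<lambda>A. of_bool (l \<in> A) * \<phi> A) \<le> hi * expect n w' \<phi>"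
    if l: "l \<in> insert j J" and \<phi>: "depends_below l \<phi>" "\<And>A. 0 \<le> \<phi> A" for l \<phi>
  proof (cases l j rule: linorder_cases)
    \<comment> \<open>Both sides of an earlier constraint are determined by coordinates before
      \<open>j\<close>, which the redraw does not change.\<close>
    case less
    have "depends_below j \<phi>" "depends_below j (\<lambda>A. of_bool (l \<in> A) * \<phi> A)"
    proof -
      show "depends_below j \<phi>" using depends_below_mono[OF \<phi>(1)] less by simp
      then show "depends_below j (\<lambda>A. of_bool (l \<in> A) * \<phi> A)"
        unfolding depends_below_def
      proof (intro allI impI)
        fix A B assume AB: "A \<inter> {..<j} = B \<inter> {..<j}"
        then have "\<phi> A = \<phi> B" by (rule depends_belowD[OF \<open>depends_below j \<phi>\<close>])
        moreover have "l \<in> A \<longleftrightarrow> l \<in> B" using AB less by blast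
        ultimately show "of_bool (l \<in> A) * \<phi> A = of_bool (l \<in> B) * \<phi> B" by simp
      qed
    qed
    then show ?thesis
      using biased_weightsD(4,5)[OF w _ \<phi>] l less by (simp add: w' resample_depends_below)
  next
    case equal
    \<comment> \<open>The redraw replaces the indicator of \<open>j \<in> A\<close> by its
      probability \<open>k A\<close>, which lies between \<open>lo\<close> and
      \<open>hi\<close>.\<close>
    have "resample j k (\<lambda>A. of_bool (l \<in> A) * \<phi> A) = (\<lambda>A. k A * \<phi> A)"
      using depends_below_insert_remove[of j \<phi>] \<phi>(1) equal by (auto simp: resample_def)
    moreover have "resample j k \<phi> = \<phi>" using \<phi>(1) equal by (simp add: resample_depends_below)
    moreover have "expect n w (\<lambda>A. lo * \<phi> A) \<le> expect n w (\<lambda>A. k A * \<phi> A)"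
      "expect n w (\<lambda>A. k A * \<phi> A) \<le> expect n w (\<lambda>A. hi * \<phi> A)"
      using k \<phi> biased_weightsD(1)[OF w] by (auto intro!: expect_mono mult_right_mono)
    ultimately show ?thesis by (simp add: w' expect_cmult)
  next
    case greater
    have "resample j k (\<lambda>A. of_bool (l \<in> A) * \<phi> A) = (\<lambda>A. of_bool (l \<in> A) * resample j k \<phi> A)"
      using greater by (auto simp: resample_def)
    moreover have "depends_below l (resample j k \<phi>)"
      using depends_below_resample[OF \<phi>(1)] depends_below_mono[OF k(1)] greater by simp
    ultimately show ?thesis
      using biased_weightsD(4,5)[OF w, of l "resample j k \<phi>"] l greater resample_nonneg[OF \<phi>(2)] k01
      by (simp add: w')
  qed
  moreover have "expect n w' (\<lambda>_. 1) = 1"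
    using biased_weightsD(3)[OF w, of 1] by (simp add: w' resample_depends_below depends_below_def)
  ultimately have "w' \<in> biased_weights n lo hi (insert j J)"
    using w' by (simp add: biased_weights_def)
  then show thesis using w'(3) by (rule that)
qed

text \<open>Starting from the point mass at the empty set, the coordinates are redrawn in increasing
  order with constant probability \<open>hi\<close>. Each redraw adds one constraint and contributes
  one factor \<open>hi\<close>.\<close>

lemma ex_biased_weights_prefix:
  assumes "0 \<le> lo" "lo \<le> hi" "hi \<le> 1" "m \<le> n"
  shows "\<exists>w\<in>biased_weights n lo hi {1..m}. expect n w (\<lambda>A. of_bool ({1..m} \<subseteq> A)) = hi ^ m"
  using assms(4)
proof (induction m)
  case 0
  have "(\<lambda>A. of_bool (A = {})) \<in> biased_weights n lo hi {}"
    using sum_mult_of_bool_singleton[of "Pow {1..n}" "{}" "\<lambda>_. 1"]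
    by (auto simp: biased_weights_def expect_def eq_commute[of "{}"])
  moreover have "expect n (\<lambda>A. of_bool (A = {})) (\<lambda>A. of_bool ({1..0} \<subseteq> A)) = 1"
    using sum_mult_of_bool_singleton[of "Pow {1..n}" "{}" "\<lambda>_. 1"]
    by (auto simp: expect_def eq_commute[of "{}"])
  ultimately show ?case by force
next
  case (Suc m)
  then obtain w where w: "w \<in> biased_weights n lo hi {1..m}"
    "expect n w (\<lambda>A. of_bool ({1..m} \<subseteq> A)) = hi ^ m" by auto
  obtain w' where w': "w' \<in> biased_weights n lo hi (insert (Suc m) {1..m})"
    "\<And>f. expect n w' f = expect n w (resample (Suc m) (\<lambda>_. hi) f)"
  proof (rule biased_weights_resample[OF w(1)])
    show "depends_below (Suc m) (\<lambda>_. hi)" by (simp add: depends_below_def)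
  qed (use assms(1-3) Suc.prems that in auto)
  have *: "resample (Suc m) (\<lambda>_. hi) (\<lambda>A. of_bool ({1..Suc m} \<subseteq> A)) =
      (\<lambda>A. hi * of_bool ({1..m} \<subseteq> A))"
  proof (rule ext)
    fix A
    have "{1..Suc m} = insert (Suc m) {1..m}" by auto
    moreover have "{1..m} \<subseteq> insert (Suc m) A \<longleftrightarrow> {1..m} \<subseteq> A" by auto
    ultimately show "resample (Suc m) (\<lambda>_. hi) (\<lambda>A. of_bool ({1..Suc m} \<subseteq> A)) A =
        hi * of_bool ({1..m} \<subseteq> A)"
      by (simp add: resample_def)
  qed
  have "expect n w' (\<lambda>A. of_bool ({1..Suc m} \<subseteq> A)) = hi ^ Suc m"
    using w(2) unfolding w'(2) * by (simp add: expect_cmult)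
  moreover have "insert (Suc m) {1..m} = {1..Suc m}" by auto
  ultimately show ?case using w'(1) by metis
qed

lemma ex_biased_weights_full:
  assumes "0 \<le> lo" "lo \<le> hi" "hi \<le> 1"
  shows "\<exists>w\<in>biased_weights n lo hi {1..n}. w {1..n} = hi ^ n"
proof -
  have "expect n w (\<lambda>A. of_bool ({1..n} \<subseteq> A)) = w {1..n}" for w
  proof -
    have "expect n w (\<lambda>A. of_bool ({1..n} \<subseteq> A)) = expect n w (\<lambda>A. of_bool (A = {1..n}))"
      by (intro expect_cong) auto
    then show ?thesis
      using sum_mult_of_bool_singleton[of "Pow {1..n}" "{1..n}" w]
      by (simp add: expect_def eq_commute[of "{1..n}"])
  qed
  then show ?thesis using ex_biased_weights_prefix[OF assms order_refl] by metis
qed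

section \<open>Optimising a single coordinate\<close>

lemma best_response_eq:
  fixes f :: "nat set \<Rightarrow> real" and lo hi :: real
  defines "D \<equiv> \<lambda>j A. f (insert j A) - f (A - {j})"
  assumes "lo \<le> hi"
  shows "best_response lo hi j f A = f (A - {j}) + (hi * max 0 (D j A) - lo * max 0 (- D j A))"
    and "best_response lo hi j f A = resample j (\<lambda>A. if 0 \<le> D j A then hi else lo) f A"
proof -
  \<comment> \<open>The value is affine in \<open>p\<close> with slope \<open>D j A\<close>, whose
    sign decides which endpoint is best. Splitting into positive and negative parts suits the
    constraints, which are tested on nonnegative functions.\<close>
  have *: "resample j (\<lambda>_. p) f A = f (A - {j}) + p * D j A" for p
    by (simp add: resample_def D_def algebra_simps)
  have "lo * D j A \<le> hi * D j A" if "0 \<le> D j A" using that assms by (intro mult_right_mono)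
  moreover have "hi * D j A \<le> lo * D j A" if "D j A < 0"
    using that assms by (intro mult_right_mono_neg) auto
  ultimately have **: "best_response lo hi j f A = f (A - {j}) + (if 0 \<le> D j A then hi else lo) * D j A"
    unfolding best_response_def * by (auto simp: max_def)
  then show "best_response lo hi j f A = f (A - {j}) + (hi * max 0 (D j A) - lo * max 0 (- D j A))"
    by (simp add: max_def)
  show "best_response lo hi j f A = resample j (\<lambda>A. if 0 \<le> D j A then hi else lo) f A"
    using ** by (simp add: resample_def D_def algebra_simps)
qed

text \<open>Membership of \<open>j\<close> is prescribed in both terms, so only the coordinates
  before \<open>j\<close> remain.\<close>

lemma depends_below_increment:
  assumes "depends_below (Suc j) f"
  shows "depends_below j (\<lambda>A. f (insert j A) - f (A - {j}) :: real)"
  unfolding depends_below_def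
proof (intro allI impI)
  fix A B assume AB: "A \<inter> {..<j} = B \<inter> {..<j}"
  then have "insert j A \<inter> {..<Suc j} = insert j B \<inter> {..<Suc j}"
    "(A - {j}) \<inter> {..<Suc j} = (B - {j}) \<inter> {..<Suc j}"
    by (auto simp: set_eq_iff less_Suc_eq)
  then show "f (insert j A) - f (A - {j}) = f (insert j B) - f (B - {j})"
    using depends_belowD[OF assms] by metis
qed

text \<open>Having \<open>j\<close> in \<open>A\<close> adds the increment \<open>D\<close> to
  \<open>f (A - {j})\<close>. The constraints tested on \<open>Dp\<close> and \<open>Dm\<close>
  bound the share of its positive part by \<open>hi\<close> from above and that of its negative part
  by \<open>lo\<close> from below.\<close>

lemma expect_le_best_response:
  assumes w: "w \<in> biased_weights n lo hi {1..n}" and j: "j \<in> {1..n}" and "lo \<le> hi"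
    and f: "depends_below (Suc j) f"
  shows "expect n w f \<le> expect n w (best_response lo hi j f)"
proof -
  define D where "D A = f (insert j A) - f (A - {j})" for A
  define Dp where "Dp A = max 0 (D A)" for A
  define Dm where "Dm A = max 0 (- D A)" for A
  have D: "depends_below j D" unfolding D_def by (rule depends_below_increment[OF f])
  then have Dpm: "depends_below j Dp" "depends_below j Dm"
    unfolding Dp_def Dm_def by (rule depends_below_comp)+
  have "f = (\<lambda>A. f (A - {j}) + (of_bool (j \<in> A) * Dp A - of_bool (j \<in> A) * Dm A))"
  proof (rule ext)
    show "f A = f (A - {j}) + (of_bool (j \<in> A) * Dp A - of_bool (j \<in> A) * Dm A)" for A
      by (cases "j \<in> A") (simp_all add: Dp_def Dm_def D_def insert_absorb max_def)
  qed
  from arg_cong[OF this, of "expect n w"] have "expect n w f = expect n w (\<lambda>A. f (A - {j})) +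
      (expect n w (\<lambda>A. of_bool (j \<in> A) * Dp A) - expect n w (\<lambda>A. of_bool (j \<in> A) * Dm A))"
    by (simp only: expect_add expect_diff)
  also have "\<dots> \<le> expect n w (\<lambda>A. f (A - {j})) + (hi * expect n w Dp - lo * expect n w Dm)"
    using biased_weightsD(5)[OF w j Dpm(1)] biased_weightsD(4)[OF w j Dpm(2)]
    by (simp add: Dp_def Dm_def)
  also have "\<dots> = expect n w (best_response lo hi j f)"
  proof -
    have "best_response lo hi j f = (\<lambda>A. f (A - {j}) + (hi * Dp A - lo * Dm A))"
      using best_response_eq(1)[OF \<open>lo \<le> hi\<close>] by (auto simp: Dp_def Dm_def D_def)
    then show ?thesis by (simp only: expect_add expect_diff expect_cmult)
  qed
  finally show ?thesis .
qed

text \<open>The optimal endpoint depends on the history only, so redrawing \<open>j\<close> with it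
  stays within the family. With the preceding bound, \<open>f\<close> and its best response have the
  same supremum of means.\<close>

lemma ex_expect_eq_best_response:
  assumes w: "w \<in> biased_weights n lo hi {1..n}" and j: "j \<in> {1..n}"
    and lohi: "0 \<le> lo" "lo \<le> hi" "hi \<le> 1"
    and f: "depends_below (Suc j) f"
  shows "\<exists>w'\<in>biased_weights n lo hi {1..n}. expect n w' f = expect n w (best_response lo hi j f)"
proof -
  define k where "k A = (if 0 \<le> f (insert j A) - f (A - {j}) then hi else lo)" for A
  have k: "depends_below j k"
    unfolding k_def by (rule depends_below_comp[OF depends_below_increment[OF f]])
  have "best_response lo hi j f = resample j k f"
    unfolding k_def by (rule ext) (rule best_response_eq(2)[OF lohi(2)])
  moreover have k_bounds: "lo \<le> k A" "k A \<le> hi" for A using lohi(2) by (auto simp: k_def)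
  obtain w' where "w' \<in> biased_weights n lo hi (insert j {1..n})"
    "\<And>f. expect n w' f = expect n w (resample j k f)"
    by (rule biased_weights_resample[where k = k, OF w j lohi(1,3) k k_bounds]) (rule that)
  ultimately show ?thesis using j by (auto simp: insert_absorb)
qed

section \<open>Convexity and compactness of the constrained weights\<close>

lemma biased_weights_mix:
  assumes w: "w \<in> biased_weights n lo hi J" and v: "v \<in> biased_weights n lo hi J"
    and u: "0 \<le> u" "u \<le> 1"
  shows "(\<lambda>A. u * w A + (1 - u) * v A) \<in> biased_weights n lo hi J"
proof -
  have lin: "expect n (\<lambda>A. u * w A + (1 - u) * v A) f = u * expect n w f + (1 - u) * expect n v f" for f
    unfolding expect_def sum_distrib_left sum.distrib[symmetric]
    by (intro sum.cong) (auto simp: algebra_simps)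
  have "lo * (u * expect n w \<phi> + (1 - u) * expect n v \<phi>) \<le>
        u * expect n w (\<lambda>A. of_bool (j \<in> A) * \<phi> A) + (1 - u) * expect n v (\<lambda>A. of_bool (j \<in> A) * \<phi> A) \<and>
      u * expect n w (\<lambda>A. of_bool (j \<in> A) * \<phi> A) + (1 - u) * expect n v (\<lambda>A. of_bool (j \<in> A) * \<phi> A) \<le>
        hi * (u * expect n w \<phi> + (1 - u) * expect n v \<phi>)"
    if "j \<in> J" "depends_below j \<phi>" "\<And>A. 0 \<le> \<phi> A" for j \<phi>
  proof -
    note ineqs = biased_weightsD(4,5)[OF w that] biased_weightsD(4,5)[OF v that]
    note * = mult_left_mono[OF ineqs(1) u(1)] mult_left_mono[OF ineqs(2) u(1)]
      mult_left_mono[OF ineqs(3), of "1 - u"] mult_left_mono[OF ineqs(4), of "1 - u"]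
    show ?thesis using * u(2) by (simp add: distrib_left mult.left_commute)
  qed
  then show ?thesis
    using biased_weightsD(1-3)[OF w] biased_weightsD(1-3)[OF v] u
    by (simp add: biased_weights_def lin)
qed

text \<open>The weights lie in a product of unit intervals, compact by Tychonoff, and all
  constraints are closed conditions in the product topology.\<close>

lemma compact_biased_weights: "compact (biased_weights n lo hi J)"
proof -
  have cont: "continuous_on UNIV (\<lambda>w. expect n w f)" for f
    unfolding expect_def by (intro continuous_intros continuous_on_product_coordinates)
  have closed: "closed (biased_weights n lo hi J)"
    unfolding biased_weights_def Ball_def
    by (intro closed_Collect_conj closed_Collect_all closed_Collect_imp
        closed_Collect_le closed_Collect_eq open_Collect_const continuous_intros cont
        continuous_on_product_coordinates)
  have "w A \<le> 1" if w: "w \<in> biased_weights n lo hi J" for w A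
  proof (cases "A \<subseteq> {1..n}")
    case True
    then have "w A \<le> (\<Sum>A\<in>Pow {1..n}. w A)"
      using biased_weightsD(1)[OF w] by (intro member_le_sum) auto
    then show ?thesis using biased_weightsD(3)[OF w, of 1] by (simp add: expect_def)
  qed (use biased_weightsD(2)[OF w] in simp)
  then have sub: "biased_weights n lo hi J \<subseteq> PiE UNIV (\<lambda>_. {0..1})"
    using biased_weightsD(1) by (auto simp: PiE_iff)
  have "compact (PiE UNIV (\<lambda>_. {0..1}) :: (nat set \<Rightarrow> real) set)"
    using compactin_PiE[of "\<lambda>_. euclidean" UNIV "\<lambda>_::nat set. {0..1::real}"]
    by (simp add: euclidean_product_topology)
  then show ?thesis
    using closed sub by (metis compact_Int_closed inf.absorb2)
qed

subsection \<open>The two-point model\<close>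

lemma bLip_cong:
  assumes "\<psi> \<in> bLip m" "\<And>j. j \<in> {1..m} \<Longrightarrow> x j = y j"
  shows "\<psi> x = \<psi> y"
proof -
  obtain L where L: "\<And>x y. \<bar>\<psi> x - \<psi> y\<bar> \<le> L * L2_set (\<lambda>j. x j - y j) {1..m}"
    using assms(1) by (auto simp: bLip_def)
  have "L2_set (\<lambda>j. x j - y j) {1..m} = 0" using assms(2) by (simp add: L2_set_def)
  then show ?thesis using L[of x y] by simp
qed

locale two_point_model =
  fixes n :: nat and g :: "nat set \<Rightarrow> 'a" and a s :: real
  assumes n: "n \<ge> 1" and a: "a > 0" and s: "s > 0" and inj: "inj_on g (Pow {1..n})"
begin

text \<open>Low enough that the upper probability \<open>hi\<close> of the high value satisfies \<open>n * (1 - hi) \<le> 1/2\<close>.\<close>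

definition bot_value :: real where "bot_value = - (a + 2 * real n * s)"

text \<open>The solution \<open>p\<close> of \<open>p * (a + s) + (1 - p) * bot_value = - a\<close>;
  with right-hand side \<open>a\<close> the solution is \<open>hi\<close>.\<close>

definition lo :: real where "lo = (- a - bot_value) / (a + s - bot_value)"

definition hi :: real where "hi = (a - bot_value) / (a + s - bot_value)"

definition val :: "nat \<Rightarrow> nat set \<Rightarrow> real" where
  "val i A = (if i \<in> A then a + s else bot_value)"

definition X :: "nat \<Rightarrow> 'a \<Rightarrow> real" where
  "X i \<omega> = val i (inv_into (Pow {1..n}) g \<omega>)"

lemma gap_pos: "a + s - bot_value > 0" "2 * real n * s \<le> a + s - bot_value"
  using a s by (simp_all add: bot_value_def add_pos_nonneg)

lemma lo_hi: "0 \<le> lo" "lo \<le> hi" "hi \<le> 1"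
  using a s gap_pos by (auto simp: lo_def hi_def bot_value_def divide_le_eq_1 intro!: divide_right_mono)

lemma lo_mean: "lo * (a + s) + (1 - lo) * bot_value = - a"
  and hi_mean: "hi * (a + s) + (1 - hi) * bot_value = a"
proof -
  have *: "p * (a + s) + (1 - p) * bot_value = p * (a + s - bot_value) + bot_value" for p
    by (simp add: algebra_simps)
  show "lo * (a + s) + (1 - lo) * bot_value = - a" "hi * (a + s) + (1 - hi) * bot_value = a"
    unfolding * using gap_pos(1) by (simp_all add: lo_def hi_def)
qed

text \<open>The two values are at least \<open>2 * n * s\<close> apart, so \<open>1 - hi\<close> is
  at most \<open>1 / (2 * n)\<close>; Bernoulli's inequality then gives even
  \<open>1 / 2\<close>.\<close>

lemma hi_power: "1 / 4 \<le> hi ^ n"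
proof -
  have "1 - hi = s / (a + s - bot_value)"
    using gap_pos(1) by (simp add: hi_def field_simps)
  also have "\<dots> \<le> s / (2 * real n * s)"
    using gap_pos s n by (intro divide_left_mono mult_pos_pos) auto
  finally have "real n * (1 - hi) \<le> 1 / 2"
    using s n by (simp add: field_simps)
  moreover have "1 + real n * (hi - 1) \<le> (1 + (hi - 1)) ^ n"
    using lo_hi by (intro Bernoulli_inequality) auto
  ultimately show ?thesis by (simp add: algebra_simps)
qed

sublocale weight_model "Pow {1..n}" g "biased_weights n lo hi {1..n}"
proof
  show "biased_weights n lo hi {1..n} \<noteq> {}"
    using ex_biased_weights_full[OF lo_hi] by blast
  show "0 \<le> w A" if "w \<in> biased_weights n lo hi {1..n}" for w A
    by (rule biased_weightsD(1)[OF that])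
  show "(\<Sum>A\<in>Pow {1..n}. w A) = 1" if "w \<in> biased_weights n lo hi {1..n}" for w
    using biased_weightsD(3)[OF that, of 1] by (simp add: expect_def)
  show "(\<lambda>A. u * w A + (1 - u) * v A) \<in> biased_weights n lo hi {1..n}"
    if "w \<in> biased_weights n lo hi {1..n}" "v \<in> biased_weights n lo hi {1..n}" "0 \<le> u" "u \<le> 1"
    for w v u
    by (rule biased_weights_mix[OF that])
qed (rule inj compact_biased_weights | simp)+

section \<open>Means and independence of the two-point variables\<close>

lemma X_g [simp]: "A \<subseteq> {1..n} \<Longrightarrow> X i (g A) = val i A"
  using inj by (simp add: X_def)

text \<open>Eliminates the last coordinate of a function of the coordinates up to \<open>j\<close>,
  whence \<open>Suc j\<close>: the best response bounds each mean and is attained after a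
  redraw.\<close>

lemma upper_expectation_best_response:
  assumes j: "j \<in> {1..n}" and f: "depends_below (Suc j) f"
    and F: "\<And>A. A \<subseteq> {1..n} \<Longrightarrow> F (g A) = f A"
    and G: "\<And>A. A \<subseteq> {1..n} \<Longrightarrow> G (g A) = best_response lo hi j f A"
  shows "upper_expectation laws F = upper_expectation laws G"
proof (rule antisym)
  have F_eq: "(\<Sum>A\<in>Pow {1..n}. w A * F (g A)) = expect n w f"
    and G_eq: "(\<Sum>A\<in>Pow {1..n}. w A * G (g A)) = expect n w (best_response lo hi j f)" for w
    by (auto simp: expect_def F G intro!: sum.cong)
  show "upper_expectation laws F \<le> upper_expectation laws G"
  proof (rule upper_expectation_leI)
    fix w assume w: "w \<in> biased_weights n lo hi {1..n}"
    show "(\<Sum>A\<in>Pow {1..n}. w A * F (g A)) \<le> upper_expectation laws G"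
      using expect_le_best_response[OF w j lo_hi(2) f] expectation_le_upper[OF w, of G]
      unfolding F_eq G_eq by linarith
  qed
  show "upper_expectation laws G \<le> upper_expectation laws F"
  proof (rule upper_expectation_leI)
    fix w assume w: "w \<in> biased_weights n lo hi {1..n}"
    obtain w' where w': "w' \<in> biased_weights n lo hi {1..n}"
      "expect n w' f = expect n w (best_response lo hi j f)"
      using ex_expect_eq_best_response[OF w j lo_hi f] by blast
    show "(\<Sum>A\<in>Pow {1..n}. w A * G (g A)) \<le> upper_expectation laws F"
      using w'(2) expectation_le_upper[OF w'(1), of F]
      unfolding F_eq G_eq by linarith
  qed
qed

lemma depends_below_val:
  assumes "i < j"
  shows "depends_below j (val i)"
  unfolding depends_below_def
proof (intro allI impI)
  fix A B assume "A \<inter> {..<j} = B \<inter> {..<j}"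
  then have "i \<in> A \<longleftrightarrow> i \<in> B" using assms by blast
  then show "val i A = val i B" by (simp add: val_def)
qed

lemma mean_set_X:
  assumes "i \<in> {1..n}"
  shows "mean_set laws (X i) = {- a..a}"
proof -
  have "upper_expectation laws (\<lambda>\<omega>. p * X i \<omega>) = a * \<bar>p\<bar>" for p
  proof -
    have "depends_below (Suc i) (\<lambda>A. p * val i A)"
      by (rule depends_below_comp[OF depends_below_val]) simp
    \<comment> \<open>The endpoint means are \<open>- a\<close> and \<open>a\<close>, so the larger
      of \<open>- p * a\<close> and \<open>p * a\<close> results for every history.\<close>
    moreover have "best_response lo hi i (\<lambda>A. p * val i A) A = a * \<bar>p\<bar>" for A
    proof -
      have "resample i (\<lambda>_. q) (\<lambda>A. p * val i A) A = p * (q * (a + s) + (1 - q) * bot_value)" for q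
        by (simp add: resample_def val_def algebra_simps)
      then show ?thesis
        using a by (simp only: best_response_def lo_mean hi_mean)
          (auto simp: max_def abs_if mult_le_0_iff zero_le_mult_iff)
    qed
    ultimately have "upper_expectation laws (\<lambda>\<omega>. p * X i \<omega>) = upper_expectation laws (\<lambda>\<omega>. a * \<bar>p\<bar>)"
      using assms by (intro upper_expectation_best_response) auto
    then show ?thesis by (simp only: upper_expectation_const)
  qed
  then have "mean_set laws (X i) = {\<theta>. \<forall>p. \<theta> * p \<le> a * \<bar>p\<bar>}"
    by (simp add: mean_set_def)
  also have "\<dots> = {- a..a}"
  proof (intro set_eqI iffI)
    fix \<theta> assume "\<theta> \<in> {\<theta>. \<forall>p. \<theta> * p \<le> a * \<bar>p\<bar>}"
    then have "\<theta> * 1 \<le> a * \<bar>1\<bar>" "\<theta> * (- 1) \<le> a * \<bar>- 1\<bar>" by blast+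
    then show "\<theta> \<in> {- a..a}" by auto
  next
    fix \<theta> assume "\<theta> \<in> {- a..a}"
    then have "\<bar>\<theta>\<bar> \<le> a" by auto
    have "\<theta> * p \<le> a * \<bar>p\<bar>" for p
    proof -
      have "\<theta> * p \<le> \<bar>\<theta>\<bar> * \<bar>p\<bar>" by (simp flip: abs_mult)
      also have "\<dots> \<le> a * \<bar>p\<bar>" using \<open>\<bar>\<theta>\<bar> \<le> a\<close> by (intro mult_right_mono) auto
      finally show ?thesis .
    qed
    then show "\<theta> \<in> {\<theta>. \<forall>p. \<theta> * p \<le> a * \<bar>p\<bar>}" by blast
  qed
  finally show ?thesis .
qed

text \<open>Eliminating coordinate \<open>i + 1\<close> from \<open>\<psi>\<close> leaves, at each
  history, the same maximum of two means as the inner upper expectation with frozen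
  arguments.\<close>

lemma independent_under_X: "independent_under laws n X"
  unfolding independent_under_def
proof (intro allI impI ballI)
  fix i \<psi>
  assume i: "1 \<le> i \<and> i < n" and \<psi>: "\<psi> \<in> bLip (i + 1)"
  define j where "j = i + 1"
  have j: "j \<in> {1..n}" using i by (simp add: j_def)
  have \<psi>_cong: "\<psi> x = \<psi> y" if "\<And>l. 1 \<le> l \<Longrightarrow> l \<le> j \<Longrightarrow> x l = y l" for x y
    using bLip_cong[OF \<psi>, of x y] that by (simp add: j_def)
  define M where "M q x = q * \<psi> (x(j := a + s)) + (1 - q) * \<psi> (x(j := bot_value))" for q and x :: "nat \<Rightarrow> real"
  \<comment> \<open>For frozen \<open>x\<close> the best response is the same for all
    \<open>A\<close>, so the upper expectation is that of a constant.\<close>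
  have inner: "upper_expectation laws (\<lambda>\<omega>'. \<psi> (x(j := X j \<omega>'))) = max (M lo x) (M hi x)" for x
  proof -
    have "depends_below (Suc j) (\<lambda>A. \<psi> (x(j := val j A)))"
      by (rule depends_below_comp[OF depends_below_val]) simp
    moreover have "best_response lo hi j (\<lambda>A. \<psi> (x(j := val j A))) A = max (M lo x) (M hi x)" for A
      by (simp add: best_response_def resample_def val_def M_def)
    ultimately have "upper_expectation laws (\<lambda>\<omega>'. \<psi> (x(j := X j \<omega>'))) =
        upper_expectation laws (\<lambda>\<omega>'. max (M lo x) (M hi x))"
      using j by (intro upper_expectation_best_response) auto
    then show ?thesis by (simp only: upper_expectation_const)
  qed
  have "depends_below (Suc j) (\<lambda>A. \<psi> (\<lambda>l. val l A))"
    unfolding depends_below_def by (intro allI impI \<psi>_cong) (rule depends_belowD[OF depends_below_val], auto)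
  moreover have "best_response lo hi j (\<lambda>A. \<psi> (\<lambda>l. val l A)) A =
      max (M lo (\<lambda>l. val l A)) (M hi (\<lambda>l. val l A))" for A
  proof -
    have "(\<lambda>l. val l (insert j A)) = (\<lambda>l. val l A)(j := a + s)"
      "(\<lambda>l. val l (A - {j})) = (\<lambda>l. val l A)(j := bot_value)"
      by (auto simp: val_def)
    then show ?thesis by (simp add: best_response_def resample_def M_def)
  qed
  ultimately have "upper_expectation laws (\<lambda>\<omega>. \<psi> (\<lambda>l. X l \<omega>)) =
      upper_expectation laws (\<lambda>\<omega>. max (M lo (\<lambda>l. X l \<omega>)) (M hi (\<lambda>l. X l \<omega>)))"
    using j by (intro upper_expectation_best_response) auto
  then show "upper_expectation laws (\<lambda>\<omega>. \<psi> (\<lambda>j. X j \<omega>)) =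
      upper_expectation laws (\<lambda>\<omega>. upper_expectation laws
        (\<lambda>\<omega>'. \<psi> ((\<lambda>j. X j \<omega>)(i + 1 := X (i + 1) \<omega>'))))"
    unfolding j_def[symmetric] inner .
qed

section \<open>Boundedness and the probability of a deviation\<close>

lemma abs_X_le: "\<bar>X i \<omega>\<bar> \<le> 2 * a + s + 2 * real n * s"
proof -
  have "0 \<le> real n * s" using s by simp
  then show ?thesis
    using a s unfolding X_def val_def bot_value_def by (split if_split) (intro conjI impI; linarith)
qed

text \<open>The upper bound keeps the set at distance at least \<open>s\<close> from
  \<open>a + s\<close>; the element 0 excludes the empty set, for which \<open>infdist\<close> is 0
  by convention.\<close>

lemma average_mean_set_X: "average_mean_set laws n X \<subseteq> {..a}" "0 \<in> average_mean_set laws n X"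
proof -
  show "average_mean_set laws n X \<subseteq> {..a}"
  proof
    fix x assume "x \<in> average_mean_set laws n X"
    then obtain \<theta> where x: "x = (\<Sum>i=1..n. \<theta> i) / real n"
      and \<theta>: "\<forall>i\<in>{1..n}. \<theta> i \<in> mean_set laws (X i)"
      unfolding average_mean_set_def by blast
    have "(\<Sum>i=1..n. \<theta> i) \<le> (\<Sum>i=1..n. a)"
      using \<theta> mean_set_X by (intro sum_mono) auto
    then show "x \<in> {..a}" using n by (simp add: x field_simps)
  qed
  show "0 \<in> average_mean_set laws n X"
    unfolding average_mean_set_def using mean_set_X a
    by (intro CollectI exI[of _ "\<lambda>_. 0"]) auto
qed

text \<open>A suitable weight gives mass \<open>hi ^ n\<close> to the single configuration in which
  all variables are high, and there the average is \<open>a + s\<close>.\<close>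

lemma upper_capacity_deviation:
  assumes "t < s"
  shows "1 / 4 \<le> upper_capacity laws {\<omega> \<in> mspace \<Omega>.
           infdist ((\<Sum>i=1..n. X i \<omega>) / real n) (average_mean_set laws n X) > t}"
    (is "_ \<le> upper_capacity laws ?B")
proof -
  obtain w where w: "w \<in> biased_weights n lo hi {1..n}" "w {1..n} = hi ^ n"
    using ex_biased_weights_full[OF lo_hi] by blast
  have "(\<Sum>i=1..n. X i (g {1..n})) = real n * (a + s)"
    by (simp add: val_def)
  then have mean: "(\<Sum>i=1..n. X i (g {1..n})) / real n = a + s" using n by simp
  have "s \<le> infdist (a + s) (average_mean_set laws n X)"
  proof -
    have "average_mean_set laws n X \<noteq> {}" using average_mean_set_X(2) by blast
    moreover have "s \<le> dist (a + s) x" if "x \<in> average_mean_set laws n X" for x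
      using average_mean_set_X(1) that by (force simp: dist_real_def)
    ultimately show ?thesis
      unfolding infdist_def by (auto intro!: cINF_greatest)
  qed
  then have "g {1..n} \<in> ?B" using assms by (intro CollectI conjI) (simp, unfold mean, linarith)
  then have "w {1..n} \<le> upper_capacity laws ?B"
    using w(1) by (intro weight_le_upper_capacity) auto
  then show ?thesis using hi_power w(2) by simp
qed

end

theorem theorem6p3:
  fixes a \<sigma> :: real and n :: nat
  assumes "a > 0" and "\<sigma> > 0" and "n \<ge> 1"
  shows "\<exists>(\<Omega> :: real metric) E \<P> X M.
    regular_sublinear_expectation_space \<Omega> E \<and>
    representing_set \<Omega> E \<P> \<and>
    (\<forall>i\<in>{1..n}. X i \<in> Lp \<Omega> \<P> 2) \<and>
    independent_under \<P> n X \<and>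
    M > 0 \<and> (\<forall>i\<in>{1..n}. \<forall>\<omega>\<in>mspace \<Omega>. \<bar>X i \<omega>\<bar> \<le> M) \<and>
    (\<forall>i\<in>{1..n}. mean_set \<P> (X i) = {-a..a}) \<and>
    (\<forall>t::real. 0 < t \<and> t \<le> \<sigma> / (4 * sqrt (real n)) \<longrightarrow>
       upper_capacity \<P>
         {\<omega> \<in> mspace \<Omega>.
            infdist ((\<Sum>i=1..n. X i \<omega>) / real n) (average_mean_set \<P> n X) > t}
       \<ge> 1/4 * exp (- (2 * real n * t\<^sup>2) / \<sigma>\<^sup>2))"
proof -
  \<comment> \<open>The carrier has to consist of reals, so the finitely many configurations are
    numbered; the metric is still the discrete one.\<close>
  obtain code :: "nat set \<Rightarrow> nat" where code: "inj_on code (Pow {1..n})"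
    using finite_imp_inj_to_nat_seg[of "Pow {1..n}"] by auto
  interpret two_point_model n "\<lambda>A. real (code A)" a \<sigma>
    using assms code by unfold_locales (auto simp: inj_on_def)
  have deviation: "1/4 * exp (- (2 * real n * t\<^sup>2) / \<sigma>\<^sup>2) \<le> upper_capacity laws {\<omega> \<in> mspace \<Omega>.
      infdist ((\<Sum>i=1..n. X i \<omega>) / real n) (average_mean_set laws n X) > t}"
    if "0 < t \<and> t \<le> \<sigma> / (4 * sqrt (real n))" for t
  proof -
    \<comment> \<open>As \<open>n \<ge> 1\<close>, the denominator exceeds 1, so \<open>t\<close>
      stays below the distance \<open>\<sigma>\<close> of the all-high average.\<close>
    have "\<sigma> / (4 * sqrt (real n)) < \<sigma> / 1"
      using assms by (intro divide_strict_left_mono) (auto simp: less_le_trans[of 1 4] mult_ge1_I)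
    then have "t < \<sigma>" using that by simp
    moreover have "1/4 * exp (- (2 * real n * t\<^sup>2) / \<sigma>\<^sup>2) \<le> 1/4"
      by simp
    ultimately show ?thesis using upper_capacity_deviation by (meson order_trans)
  qed
  show ?thesis
  proof (rule exI[of _ \<Omega>], rule exI[of _ "upper_expectation laws"], rule exI[of _ laws],
      rule exI[of _ X], rule exI[of _ "2 * a + \<sigma> + 2 * real n * \<sigma>"], intro conjI ballI allI impI)
    show "0 < 2 * a + \<sigma> + 2 * real n * \<sigma>" using assms by (simp add: add_pos_nonneg)
    show "X i \<in> Lp \<Omega> laws 2" for i by (rule in_Lp_laws) simp
  qed (simp_all only: regular_sublinear_expectation_space_laws representing_set_laws
      independent_under_X abs_X_le mean_set_X deviation)
qed

end
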